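(* Let $p\in(0,\tfrac12]$ and let $f\in L^2(\{0,1\}^n,\mu_p)$. Suppose that $f$ has $\beta$-small generalised influences, i.e. $\mathrm{I}_S(f)\le \beta\,\mathbb{E}_{\mu_p}[f^2]$ for all $S\subseteq[n]$. Then \[\|\mathrm{T}_{1/5} f\|_4\le \beta^{1/4}\|f\|_2,\] where all norms are taken in $L^r(\{0,1\}^n,\mu_p)$.
   Context: $\mu_p$ denotes the $p$-biased product measure on $\{0,1\}^n$, $\mu_p(x)=p^{|x|}(1-p)^{n-|x|}$ with $|x|$ the number of ones of $x$. For $S\subseteq[n]$ and $x\in\{0,1\}^S$, $f_{S\to x}$ denotes the function on $\{0,1\}^{[n]\setminus S}$ obtained from $f$ by fixing the coordinates in $S$ to $x$. The generalised influence is \[\mathrm{I}_S(f)=\mathbb{E}_{\mu_p}\Big[\Big(\sum_{x\in\{0,1\}^S}(-1)^{|S|-|x|}f_{S\to x}\Big)^2\Big]\] (expectation over the remaining coordinates w.r.t. $\mu_p$). The noise operator is $\mathrm{T}_\rho f(x)=\mathbb{E}_{\mathbf{y}\sim N_\rho(x)}[f(\mathbf{y})]$, where $\mathbf{y}\sim N_\rho(x)$ is obtained independently for each $i$ by setting $\mathbf{y}_i=x_i$ with probability $\rho$ and otherwise resampling $\mathbf{y}_i$ with $\Pr[\mathbf{y}_i=1]=p$. *)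

theory Defs
  imports "HOL-Probability.Probability"
begin

text \<open>
  A point of \<open>{0,1}\<^sup>V\<close>, for a finite index set \<open>V\<close>, is a function that is \<open>False\<close>
  outside \<open>V\<close>, with \<open>True\<close> for 1 and \<open>False\<close> for 0; a function on \<open>{0,1}\<^sup>V\<close> is a
  function of type \<open>('a \<Rightarrow> bool) \<Rightarrow> real\<close>, of which only the values at these points matter.
\<close>

definition cube :: "'a set \<Rightarrow> ('a \<Rightarrow> bool) set" where
  "cube V = PiE_dflt V False (\<lambda>_. UNIV)"

definition weight :: "'a set \<Rightarrow> ('a \<Rightarrow> bool) \<Rightarrow> nat" where
  "weight V x = card {i \<in> V. x i}"

definition mu :: "real \<Rightarrow> 'a set \<Rightarrow> ('a \<Rightarrow> bool) pmf" where
  "mu p V = Pi_pmf V False (\<lambda>_. bernoulli_pmf p)"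

lemma pmf_mu:
  assumes "finite V" "0 \<le> p" "p \<le> 1" "x \<in> cube V"
  shows "pmf (mu p V) x = p ^ weight V x * (1 - p) ^ (card V - weight V x)"
proof -
  have "pmf (mu p V) x = (\<Prod>i\<in>V. pmf (bernoulli_pmf p) (x i))"
    unfolding mu_def using assms by (intro pmf_Pi') (auto simp: cube_def PiE_dflt_def)
  also have "\<dots> = (\<Prod>i\<in>V. if x i then p else 1 - p)"
    using assms by (intro prod.cong) (auto simp: pmf_bernoulli_True pmf_bernoulli_False)
  also have "\<dots> = p ^ card {i \<in> V. x i} * (1 - p) ^ card {i \<in> V. \<not> x i}"
    using assms by (simp add: prod.If_cases Int_def)
  also have "{i \<in> V. \<not> x i} = V - {i \<in> V. x i}"
    by auto
  finally show ?thesis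
    using assms by (simp add: weight_def card_Diff_subset)
qed

definition fix_coords :: "'a set \<Rightarrow> ('a \<Rightarrow> bool) \<Rightarrow> (('a \<Rightarrow> bool) \<Rightarrow> real) \<Rightarrow> ('a \<Rightarrow> bool) \<Rightarrow> real" where
  "fix_coords S x f = (\<lambda>y. f (\<lambda>i. if i \<in> S then x i else y i))"

definition gen_influence :: "real \<Rightarrow> 'a set \<Rightarrow> 'a set \<Rightarrow> (('a \<Rightarrow> bool) \<Rightarrow> real) \<Rightarrow> real" where
  "gen_influence p V S f =
     measure_pmf.expectation (mu p (V - S))
       (\<lambda>y. (\<Sum>x\<in>cube S. (- 1) ^ (card S - weight S x) * fix_coords S x f y)\<^sup>2)"

definition small_gen_influences :: "real \<Rightarrow> real \<Rightarrow> 'a set \<Rightarrow> (('a \<Rightarrow> bool) \<Rightarrow> real) \<Rightarrow> bool" where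
  "small_gen_influences \<beta> p V f \<longleftrightarrow>
     (\<forall>S\<subseteq>V. gen_influence p V S f \<le> \<beta> * measure_pmf.expectation (mu p V) (\<lambda>x. (f x)\<^sup>2))"

definition noise_dist :: "real \<Rightarrow> real \<Rightarrow> 'a set \<Rightarrow> ('a \<Rightarrow> bool) \<Rightarrow> ('a \<Rightarrow> bool) pmf" where
  "noise_dist \<rho> p V x =
     Pi_pmf V False
       (\<lambda>i. bernoulli_pmf \<rho> \<bind> (\<lambda>keep. if keep then return_pmf (x i) else bernoulli_pmf p))"

definition noise :: "real \<Rightarrow> real \<Rightarrow> 'a set \<Rightarrow> (('a \<Rightarrow> bool) \<Rightarrow> real) \<Rightarrow> ('a \<Rightarrow> bool) \<Rightarrow> real" where
  "noise \<rho> p V f x = measure_pmf.expectation (noise_dist \<rho> p V x) f"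

definition mu_norm :: "real \<Rightarrow> real \<Rightarrow> 'a set \<Rightarrow> (('a \<Rightarrow> bool) \<Rightarrow> real) \<Rightarrow> real" where
  "mu_norm r p V f = measure_pmf.expectation (mu p V) (\<lambda>x. \<bar>f x\<bar> powr r) powr (1 / r)"

end

theory Submission
  imports Defs
begin

text \<open>
  Writing \<open>f = E\<^sub>v f + (x\<^sub>v - p) D\<^sub>v f\<close> in one coordinate \<open>v\<close>, AM-GM bounds the mean over \<open>x\<^sub>v\<close> of
  \<open>(T\<^sub>\<rho> f)\<^sup>2 (T\<^sub>\<rho> g)\<^sup>2\<close> by a combination of products of squares of the same shape. This
  two-function form therefore tensorises: by induction on the number of coordinates,
  \<open>\<bbbE> (T\<^sub>\<rho> f)\<^sup>2 (T\<^sub>\<rho> g)\<^sup>2 \<le> \<Sum>\<^sub>S (\<lambda> p (1 - p))\<^bsup>|S|\<^esup> I\<^sub>S(T\<^sub>r f) I\<^sub>S(T\<^sub>r g)\<close>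
  whenever \<open>3 \<rho>\<^sup>2 + \<rho>\<^sup>3 \<le> r\<^sup>2\<close> and \<open>2 \<rho>\<^sup>3 + \<rho>\<^sup>4 \<le> \<lambda> r\<^sup>4\<close>. For \<open>g = f\<close>, one factor
  \<open>I\<^sub>S(T\<^sub>r f) \<le> I\<^sub>S(f)\<close> is at most \<open>\<beta> \<parallel>f\<parallel>\<^sub>2\<^sup>2\<close>, and the remaining weighted sum of influences is
  at most \<open>\<parallel>f\<parallel>\<^sub>2\<^sup>2\<close> if \<open>(1 + \<lambda>) r\<^sup>2 \<le> 1\<close>. For \<open>\<rho> = 1/5\<close> one can take \<open>r = 1/2\<close> and \<open>\<lambda> = 3\<close>.
\<close>

text \<open>The value of the argument at \<open>v\<close> is overwritten, so this function and
  \<open>coord_diff\<close> are constant in that coordinate and serve as functions on the cube over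
  the remaining coordinates without a change of type.\<close>

definition coord_mean :: "real \<Rightarrow> 'a \<Rightarrow> (('a \<Rightarrow> bool) \<Rightarrow> real) \<Rightarrow> ('a \<Rightarrow> bool) \<Rightarrow> real" where
  "coord_mean p v f x = p * f (x(v := True)) + (1 - p) * f (x(v := False))"

definition coord_diff :: "'a \<Rightarrow> (('a \<Rightarrow> bool) \<Rightarrow> real) \<Rightarrow> ('a \<Rightarrow> bool) \<Rightarrow> real" where
  "coord_diff v f x = f (x(v := True)) - f (x(v := False))"

section \<open>Expectations over product measures, one coordinate at a time\<close>

lemma finite_set_Pi_pmf_bool:
  fixes q :: "'a \<Rightarrow> bool pmf"
  assumes "finite V"
  shows "finite (set_pmf (Pi_pmf V d q))"
  by (rule finite_subset[OF set_Pi_pmf_subset'[OF assms]]) (simp add: assms finite_PiE_dflt)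

lemma integrable_Pi_pmf_bool:
  fixes q :: "'a \<Rightarrow> bool pmf" and h :: "('a \<Rightarrow> bool) \<Rightarrow> real"
  assumes "finite V"
  shows "integrable (measure_pmf (Pi_pmf V d q)) h"
  by (intro integrable_measure_pmf_finite finite_set_Pi_pmf_bool assms)

lemma integrable_mu [simp]: "finite V \<Longrightarrow> integrable (measure_pmf (mu p V)) (h :: _ \<Rightarrow> real)"
  unfolding mu_def by (rule integrable_Pi_pmf_bool)

lemma integrable_noise_dist [simp]:
  "finite V \<Longrightarrow> integrable (measure_pmf (noise_dist \<rho> p V x)) (h :: _ \<Rightarrow> real)"
  unfolding noise_dist_def by (rule integrable_Pi_pmf_bool)

text \<open>Fubini in the coordinate \<open>v\<close>. The distribution \<open>q\<close> is left
  arbitrary so that one formula covers both \<open>mu\<close> and the noise distribution around a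
  point.\<close>

lemma expectation_Pi_pmf_insert_bool:
  fixes q :: "'a \<Rightarrow> bool pmf" and h :: "('a \<Rightarrow> bool) \<Rightarrow> real"
  assumes "finite V" "v \<notin> V"
  shows "measure_pmf.expectation (Pi_pmf (insert v V) d q) h =
    measure_pmf.expectation (Pi_pmf V d q) (coord_mean (pmf (q v) True) v h)"
proof -
  let ?E = "measure_pmf.expectation (Pi_pmf V d q)"
  have "measure_pmf.expectation (Pi_pmf (insert v V) d q) h =
      (\<Sum>b\<in>UNIV. pmf (q v) b *\<^sub>R measure_pmf.expectation
         (map_pmf (\<lambda>x. x(v := b)) (Pi_pmf V d q)) h)"
    unfolding Pi_pmf_insert'[OF assms] map_pmf_def[symmetric]
    by (rule pmf_expectation_bind) (auto simp: finite_set_Pi_pmf_bool assms(1))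
  also have "\<dots> = pmf (q v) True * ?E (\<lambda>x. h (x(v := True)))
      + (1 - pmf (q v) True) * ?E (\<lambda>x. h (x(v := False)))"
    by (simp add: UNIV_bool pmf_False_conv_True)
  also have "\<dots> = ?E (coord_mean (pmf (q v) True) v h)"
    unfolding coord_mean_def[abs_def] by (simp add: integrable_Pi_pmf_bool assms(1))
  finally show ?thesis .
qed

lemma expectation_mu_insert:
  assumes "finite V" "v \<notin> V" "0 \<le> p" "p \<le> 1"
  shows "measure_pmf.expectation (mu p (insert v V)) h =
    measure_pmf.expectation (mu p V) (coord_mean p v h)"
  unfolding mu_def using assms by (simp add: expectation_Pi_pmf_insert_bool)

section \<open>The noise operator in one coordinate\<close>

lemma noise_insert:
  assumes "finite V" "v \<notin> V" "0 \<le> p" "p \<le> 1" "0 \<le> \<rho>" "\<rho> \<le> 1"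
  shows "noise \<rho> p (insert v V) f x =
    noise \<rho> p V (coord_mean p v f) x + \<rho> * (of_bool (x v) - p) * noise \<rho> p V (coord_diff v f) x"
proof -
  let ?q = "bernoulli_pmf \<rho> \<bind> (\<lambda>keep. if keep then return_pmf (x v) else bernoulli_pmf p)"
  \<comment> \<open>The noisy coordinate is again Bernoulli: it keeps \<open>x v\<close> with
    probability \<rho> and is otherwise resampled with bias \<open>p\<close>. Averaging
    \<open>f\<close> with the shifted bias adds the shift times
    \<open>coord_diff v f\<close>.\<close>
  have q: "pmf ?q True = p + \<rho> * (of_bool (x v) - p)"
    using assms by (simp add: pmf_bind algebra_simps)
  have "noise \<rho> p (insert v V) f x =
      measure_pmf.expectation (noise_dist \<rho> p V x) (coord_mean (pmf ?q True) v f)"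
    unfolding noise_def noise_dist_def by (rule expectation_Pi_pmf_insert_bool[OF assms(1,2)])
  also have "coord_mean (pmf ?q True) v f =
      (\<lambda>y. coord_mean p v f y + \<rho> * (of_bool (x v) - p) * coord_diff v f y)"
    unfolding q by (simp add: fun_eq_iff coord_mean_def coord_diff_def algebra_simps)
  finally show ?thesis
    using assms(1) by (simp add: noise_def)
qed

text \<open>Only the coordinates in \<open>V\<close> of the base point enter the noise distribution.
  Hence all dependence on \<open>x v\<close> in \<open>noise_insert\<close> sits in the factor
  \<open>of_bool (x v) - p\<close>.\<close>

lemma noise_upd:
  assumes "finite V" "v \<notin> V"
  shows "noise \<rho> p V f (x(v := b)) = noise \<rho> p V f x"
proof -
  have "noise_dist \<rho> p V (x(v := b)) = noise_dist \<rho> p V x"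
    unfolding noise_dist_def
  proof (intro Pi_pmf_cong assms(1) refl)
    fix i assume "i \<in> V"
    then have "(x(v := b)) i = x i"
      using assms(2) by auto
    then show "bernoulli_pmf \<rho> \<bind> (\<lambda>keep. if keep then return_pmf ((x(v := b)) i) else bernoulli_pmf p)
        = bernoulli_pmf \<rho> \<bind> (\<lambda>keep. if keep then return_pmf (x i) else bernoulli_pmf p)"
      by (simp only:)
  qed
  then show ?thesis
    by (simp add: noise_def)
qed

text \<open>The factor \<open>of_bool (x v) - p\<close> in \<open>noise_insert\<close> has mean
  zero, which removes the second term.\<close>

lemma coord_mean_noise:
  assumes "finite V" "v \<notin> V" "0 \<le> p" "p \<le> 1" "0 \<le> \<rho>" "\<rho> \<le> 1"
  shows "coord_mean p v (noise \<rho> p (insert v V) f) = noise \<rho> p V (coord_mean p v f)"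
proof
  fix x
  show "coord_mean p v (noise \<rho> p (insert v V) f) x = noise \<rho> p V (coord_mean p v f) x"
    unfolding coord_mean_def[of p v "noise _ _ _ _"] noise_insert[OF assms] noise_upd[OF assms(1,2)]
    by (simp add: algebra_simps)
qed

text \<open>The same factor changes by exactly 1 between the two values of \<open>x v\<close>, so
  noise damps a difference by \<rho>.\<close>

lemma coord_diff_noise:
  assumes "finite V" "v \<notin> V" "0 \<le> p" "p \<le> 1" "0 \<le> \<rho>" "\<rho> \<le> 1"
  shows "coord_diff v (noise \<rho> p (insert v V) f) = (\<lambda>x. \<rho> * noise \<rho> p V (coord_diff v f) x)"
proof
  fix x
  show "coord_diff v (noise \<rho> p (insert v V) f) x = \<rho> * noise \<rho> p V (coord_diff v f) x"
    unfolding coord_diff_def[of v "noise _ _ _ _"] noise_insert[OF assms] noise_upd[OF assms(1,2)]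
    by (simp add: algebra_simps)
qed

section \<open>The cube, and the recursion of generalised influences in one coordinate\<close>

lemma finite_cube: "finite S \<Longrightarrow> finite (cube S)"
  unfolding cube_def by (simp add: finite_PiE_dflt)

lemma cube_empty [simp]: "cube {} = {\<lambda>_. False}"
  by (auto simp: cube_def PiE_dflt_def fun_eq_iff)

lemma cube_insert:
  "cube (insert v S) = (\<lambda>x. x(v := True)) ` cube S \<union> (\<lambda>x. x(v := False)) ` cube S" if "v \<notin> S"
proof (intro equalityI subsetI)
  fix x assume x: "x \<in> cube (insert v S)"
  have "x(v := False) \<in> cube S"
    using x by (auto simp: cube_def PiE_dflt_def)
  moreover have "x = (x(v := False))(v := x v)"
    by (simp add: fun_eq_iff)
  ultimately have "x \<in> (\<lambda>y. y(v := x v)) ` cube S"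
    by blast
  then show "x \<in> (\<lambda>x. x(v := True)) ` cube S \<union> (\<lambda>x. x(v := False)) ` cube S"
    by (cases "x v") simp_all
qed (use that in \<open>auto simp: cube_def PiE_dflt_def\<close>)

lemma sum_cube_insert:
  fixes h :: "('a \<Rightarrow> bool) \<Rightarrow> 'b :: comm_monoid_add"
  assumes "finite S" "v \<notin> S"
  shows "(\<Sum>x\<in>cube (insert v S). h x) = (\<Sum>x\<in>cube S. h (x(v := True)) + h (x(v := False)))"
proof -
  have inj: "inj_on (\<lambda>x. x(v := b)) (cube S)" for b
  proof (rule inj_onI)
    fix x y assume "x \<in> cube S" "y \<in> cube S" and eq: "x(v := b) = y(v := b)"
    then have "x v = y v"
      using assms(2) by (simp add: cube_def PiE_dflt_def)
    moreover have "x i = y i" if "i \<noteq> v" for i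
      using fun_cong[OF eq, of i] that by simp
    ultimately show "x = y"
      unfolding fun_eq_iff by metis
  qed
  have "(\<lambda>x. x(v := True)) ` cube S \<inter> (\<lambda>x. x(v := False)) ` cube S = {}"
    by (auto dest: fun_cong[of _ _ v])
  then show ?thesis
    unfolding cube_insert[OF assms(2)]
    by (simp add: sum.union_disjoint finite_cube assms(1) sum.reindex inj sum.distrib o_def)
qed

lemma gen_influence_nonneg: "0 \<le> gen_influence p V S f"
  unfolding gen_influence_def by (intro Bochner_Integration.integral_nonneg) simp

lemma gen_influence_empty:
  "gen_influence p V {} f = measure_pmf.expectation (mu p V) (\<lambda>x. (f x)\<^sup>2)"
  by (simp add: gen_influence_def weight_def fix_coords_def)

lemma gen_influence_scale:
  "gen_influence p V S (\<lambda>x. c * f x) = c\<^sup>2 * gen_influence p V S f"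
proof -
  have "(\<Sum>x\<in>cube S. (- 1) ^ (card S - weight S x) * fix_coords S x (\<lambda>x. c * f x) y)
      = c * (\<Sum>x\<in>cube S. (- 1) ^ (card S - weight S x) * fix_coords S x f y)" for y
    by (simp add: fix_coords_def sum_distrib_left mult_ac)
  then show ?thesis
    by (simp add: gen_influence_def power_mult_distrib)
qed

text \<open>The second moment of a two-valued variable is its squared mean plus its variance, and
  the variance is \<open>p * (1 - p)\<close> times the squared gap. This is applied to the signed
  sum over \<open>cube S\<close>, which commutes with both operators in \<open>v\<close> because
  \<open>v\<close> lies outside \<open>S\<close>.\<close>

lemma gen_influence_insert_notin:
  assumes "finite V" "v \<notin> V" "S \<subseteq> V" "0 \<le> p" "p \<le> 1"
  shows "gen_influence p (insert v V) S f =
    gen_influence p V S (coord_mean p v f) + p * (1 - p) * gen_influence p V S (coord_diff v f)"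
proof -
  define D where "D g y = (\<Sum>x\<in>cube S. (- 1) ^ (card S - weight S x) * fix_coords S x g y)" for g y
  have "v \<notin> S"
    using assms by auto
  then have upd: "fix_coords S x f (y(v := b)) = fix_coords S x (\<lambda>z. f (z(v := b))) y" for x y b
    unfolding fix_coords_def by (intro arg_cong[of _ _ f]) (auto simp: fun_eq_iff)
  have fix_mean: "fix_coords S x (coord_mean p v f) y
      = p * fix_coords S x f (y(v := True)) + (1 - p) * fix_coords S x f (y(v := False))" for x y
    unfolding upd by (simp add: fix_coords_def coord_mean_def)
  have fix_diff: "fix_coords S x (coord_diff v f) y
      = fix_coords S x f (y(v := True)) - fix_coords S x f (y(v := False))" for x y
    unfolding upd by (simp add: fix_coords_def coord_diff_def)
  have D_mean: "D (coord_mean p v f) y = p * D f (y(v := True)) + (1 - p) * D f (y(v := False))" for y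
    unfolding D_def fix_mean sum_distrib_left sum.distrib[symmetric]
    by (intro sum.cong) (auto simp: algebra_simps)
  have D_diff: "D (coord_diff v f) y = D f (y(v := True)) - D f (y(v := False))" for y
    unfolding D_def fix_diff sum_subtractf[symmetric]
    by (intro sum.cong) (auto simp: algebra_simps)
  have "coord_mean p v (\<lambda>y. (D f y)\<^sup>2) =
      (\<lambda>y. (D (coord_mean p v f) y)\<^sup>2 + p * (1 - p) * (D (coord_diff v f) y)\<^sup>2)"
    unfolding D_mean D_diff by (simp add: fun_eq_iff coord_mean_def power2_eq_square algebra_simps)
  moreover have "insert v V - S = insert v (V - S)"
    using \<open>v \<notin> S\<close> by auto
  ultimately show ?thesis
    using assms unfolding gen_influence_def D_def[symmetric] by (simp add: expectation_mu_insert)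
qed

text \<open>Summing over the two values at \<open>v\<close> with opposite signs produces
  \<open>coord_diff v f\<close>; the coordinates left to average are the same on both sides.\<close>

lemma gen_influence_insert_insert:
  assumes "finite V" "v \<notin> V" "S \<subseteq> V"
  shows "gen_influence p (insert v V) (insert v S) f = gen_influence p V S (coord_diff v f)"
proof -
  have "finite S" and v: "v \<notin> S"
    using assms finite_subset by auto
  have w: "weight (insert v S) (x(v := True)) = Suc (weight S x)"
    "weight (insert v S) (x(v := False)) = weight S x" for x
  proof -
    have "{i \<in> insert v S. (x(v := True)) i} = insert v {i \<in> S. x i}"
      "{i \<in> insert v S. (x(v := False)) i} = {i \<in> S. x i}"
      using v by auto
    then show "weight (insert v S) (x(v := True)) = Suc (weight S x)"
      "weight (insert v S) (x(v := False)) = weight S x"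
      using v \<open>finite S\<close> by (simp_all add: weight_def)
  qed
  \<comment> \<open>Setting \<open>v\<close> to \<open>True\<close> raises both cardinality and
    weight and keeps the exponent; \<open>False\<close> raises only the cardinality and flips the
    sign. The bound makes the truncated subtraction respect this.\<close>
  have le: "weight S x \<le> card S" for x
    unfolding weight_def using \<open>finite S\<close> by (intro card_mono) auto
  have c: "fix_coords (insert v S) (x(v := b)) f y = fix_coords S x (\<lambda>z. f (z(v := b))) y" for x b y
    unfolding fix_coords_def using v by (intro arg_cong[of _ _ f]) (auto simp: fun_eq_iff)
  have "(\<Sum>x\<in>cube (insert v S). (- 1) ^ (card (insert v S) - weight (insert v S) x)
        * fix_coords (insert v S) x f y)
      = (\<Sum>x\<in>cube S. (- 1) ^ (card S - weight S x) * fix_coords S x (coord_diff v f) y)" for y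
    unfolding sum_cube_insert[OF \<open>finite S\<close> v] w c
    using v \<open>finite S\<close> le
    by (simp add: Suc_diff_le fix_coords_def coord_diff_def algebra_simps)
  moreover have "insert v V - insert v S = V - S"
    using assms by auto
  ultimately show ?thesis
    by (simp add: gen_influence_def)
qed

section \<open>Generalised influences after noise\<close>

lemma gen_influence_noise_insert_notin:
  assumes "finite V" "v \<notin> V" "S \<subseteq> V" "0 \<le> p" "p \<le> 1" "0 \<le> r" "r \<le> 1"
  shows "gen_influence p (insert v V) S (noise r p (insert v V) f) =
    gen_influence p V S (noise r p V (coord_mean p v f))
    + p * (1 - p) * r\<^sup>2 * gen_influence p V S (noise r p V (coord_diff v f))"
  using assms
  by (simp add: gen_influence_insert_notin coord_mean_noise coord_diff_noise gen_influence_scale)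

lemma gen_influence_noise_insert_insert:
  assumes "finite V" "v \<notin> V" "S \<subseteq> V" "0 \<le> p" "p \<le> 1" "0 \<le> r" "r \<le> 1"
  shows "gen_influence p (insert v V) (insert v S) (noise r p (insert v V) f) =
    r\<^sup>2 * gen_influence p V S (noise r p V (coord_diff v f))"
  using assms by (simp add: gen_influence_insert_insert coord_diff_noise gen_influence_scale)

lemma sum_Pow_insert:
  fixes h :: "'a set \<Rightarrow> 'b :: comm_monoid_add"
  assumes "finite V" "v \<notin> V"
  shows "(\<Sum>S\<in>Pow (insert v V). h S) = (\<Sum>S\<in>Pow V. h S + h (insert v S))"
proof -
  have "inj_on (insert v) (Pow V)"
    using assms(2) by (intro inj_onI) (metis PowD insert_ident subsetD)
  moreover have "Pow V \<inter> insert v ` Pow V = {}"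
    using assms(2) by auto
  ultimately show ?thesis
    by (simp add: Pow_insert sum.union_disjoint assms(1) sum.reindex sum.distrib)
qed

text \<open>Noise passes through the mean in a coordinate unchanged and through the difference with
  a factor \<open>r\<close>, so each step of the recursion gains at most a factor
  \<open>r\<^sup>2\<close>, which is at most 1.\<close>

lemma gen_influence_noise_le:
  assumes "finite V" "S \<subseteq> V" "0 \<le> p" "p \<le> 1" "0 \<le> r" "r \<le> 1"
  shows "gen_influence p V S (noise r p V f) \<le> gen_influence p V S f"
  using assms(1,2)
proof (induction V arbitrary: S f rule: finite_induct)
  \<comment> \<open>Without coordinates both distributions are point masses at the
    all-\<open>False\<close> point, so both sides are the squared value there.\<close>
  case empty
  then show ?case
    by (simp add: gen_influence_empty mu_def noise_def noise_dist_def)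
next
  case (insert v V)
  note pr = assms(3-6)
  have r2: "r\<^sup>2 \<le> 1"
    using pr by (simp add: power_le_one)
  show ?case
  proof (cases "v \<in> S")
    case True
    then obtain S' where S': "S = insert v S'" "S' \<subseteq> V"
      using insert.prems by (metis Diff_subset insert_Diff subset_insert_iff)
    have "r\<^sup>2 * gen_influence p V S' (noise r p V (coord_diff v f))
        \<le> gen_influence p V S' (noise r p V (coord_diff v f))"
      using r2 by (intro mult_left_le_one_le gen_influence_nonneg) auto
    also have "\<dots> \<le> gen_influence p V S' (coord_diff v f)"
      by (rule insert.IH[OF S'(2)])
    finally show ?thesis
      using insert.hyps S' pr
      by (simp add: coord_diff_noise gen_influence_insert_insert gen_influence_scale)
  next
    case False
    then have S: "S \<subseteq> V"
      using insert.prems by auto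
    have "r\<^sup>2 * gen_influence p V S (noise r p V (coord_diff v f))
        \<le> gen_influence p V S (noise r p V (coord_diff v f))"
      using r2 by (intro mult_left_le_one_le gen_influence_nonneg) auto
    also have "\<dots> \<le> gen_influence p V S (coord_diff v f)"
      by (rule insert.IH[OF S])
    finally have "p * (1 - p) * (r\<^sup>2 * gen_influence p V S (noise r p V (coord_diff v f)))
        \<le> p * (1 - p) * gen_influence p V S (coord_diff v f)"
      using pr by (intro mult_left_mono) auto
    then show ?thesis
      using insert.hyps S pr insert.IH[OF S, of "coord_mean p v f"]
      by (simp add: coord_mean_noise coord_diff_noise gen_influence_insert_notin
          gen_influence_scale mult.assoc)
  qed
qed

text \<open>When \<open>v\<close> is added, the part coming from \<open>coord_diff v f\<close>
  collects \<open>p * (1 - p) * r\<^sup>2\<close> from the sets without \<open>v\<close> and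
  \<open>l\<close> times as much from the sets with \<open>v\<close>. The total is at most
  \<open>p * (1 - p)\<close>, the coefficient in the matching decomposition of the second
  moment.\<close>

lemma sum_gen_influence_noise_le:
  assumes "finite V" "0 \<le> p" "p \<le> 1" "0 \<le> r" "r \<le> 1" "(1 + l) * r\<^sup>2 \<le> 1" "0 \<le> l"
  shows "(\<Sum>S\<in>Pow V. (l * (p * (1 - p))) ^ card S * gen_influence p V S (noise r p V f))
    \<le> measure_pmf.expectation (mu p V) (\<lambda>x. (f x)\<^sup>2)"
  using assms(1)
proof (induction V arbitrary: f rule: finite_induct)
  case empty
  then show ?case
    by (simp add: gen_influence_empty mu_def noise_def noise_dist_def)
next
  case (insert v V)
  note pr = assms(2-5)
  let ?s = "p * (1 - p)"
  let ?K = "\<lambda>f S. gen_influence p V S (noise r p V f)"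
  let ?Q = "\<lambda>f. \<Sum>S\<in>Pow V. (l * ?s) ^ card S * ?K f S"
  let ?E = "\<lambda>f. measure_pmf.expectation (mu p V) (\<lambda>x. (f x)\<^sup>2)"
  have fin: "finite S" "v \<notin> S" if "S \<in> Pow V" for S
    using that insert.hyps finite_subset by auto
  have "(\<Sum>S\<in>Pow (insert v V). (l * ?s) ^ card S
        * gen_influence p (insert v V) S (noise r p (insert v V) f))
      = (\<Sum>S\<in>Pow V. (l * ?s) ^ card S * ?K (coord_mean p v f) S
          + ?s * ((1 + l) * r\<^sup>2) * ((l * ?s) ^ card S * ?K (coord_diff v f) S))"
    unfolding sum_Pow_insert[OF insert.hyps(1,2)]
    using insert.hyps pr fin
    by (intro sum.cong) (auto simp: gen_influence_noise_insert_notin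
        gen_influence_noise_insert_insert algebra_simps)
  also have "\<dots> = ?Q (coord_mean p v f) + ?s * ((1 + l) * r\<^sup>2) * ?Q (coord_diff v f)"
    by (simp only: sum.distrib sum_distrib_left)
  also have "\<dots> \<le> ?E (coord_mean p v f) + ?s * ?E (coord_diff v f)"
  proof (intro add_mono insert.IH)
    have E0: "0 \<le> ?E (coord_diff v f)"
      by (intro Bochner_Integration.integral_nonneg) simp
    have "(1 + l) * r\<^sup>2 * ?Q (coord_diff v f) \<le> (1 + l) * r\<^sup>2 * ?E (coord_diff v f)"
      using assms(7) by (intro mult_left_mono insert.IH) auto
    also have "\<dots> \<le> ?E (coord_diff v f)"
      using assms(6,7) by (intro mult_left_le_one_le E0) auto
    finally have "(1 + l) * r\<^sup>2 * ?Q (coord_diff v f) \<le> ?E (coord_diff v f)" .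
    then have "?s * ((1 + l) * r\<^sup>2 * ?Q (coord_diff v f)) \<le> ?s * ?E (coord_diff v f)"
      using pr by (intro mult_left_mono) auto
    then show "?s * ((1 + l) * r\<^sup>2) * ?Q (coord_diff v f) \<le> ?s * ?E (coord_diff v f)"
      by (simp only: mult.assoc)
  qed
  \<comment> \<open>For \<open>S = {}\<close> the influence recursion is the decomposition of the
    second moment in \<open>v\<close>.\<close>
  also have "\<dots> = measure_pmf.expectation (mu p (insert v V)) (\<lambda>x. (f x)\<^sup>2)"
    using gen_influence_insert_notin[OF insert.hyps(1,2) empty_subsetI pr(1,2), of f]
    by (simp add: gen_influence_empty)
  finally show ?case .
qed

section \<open>The two-point inequality and its tensorisation\<close>

lemma two_point_inequality:
  fixes a b c d p \<rho> :: real
  assumes "0 \<le> p" "p \<le> 1" "0 \<le> \<rho>"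
  shows "p * ((a + \<rho> * (1 - p) * b)\<^sup>2 * (c + \<rho> * (1 - p) * d)\<^sup>2)
      + (1 - p) * ((a + \<rho> * (0 - p) * b)\<^sup>2 * (c + \<rho> * (0 - p) * d)\<^sup>2)
    \<le> a\<^sup>2 * c\<^sup>2 + p * (1 - p) * ((3 * \<rho>\<^sup>2 + \<rho>^3) * (a\<^sup>2 * d\<^sup>2 + b\<^sup>2 * c\<^sup>2)
        + (2 * \<rho>^3 + \<rho>^4) * (b\<^sup>2 * d\<^sup>2))" (is "?L \<le> ?R")
proof -
  define s where "s = p * (1 - p)"
  have s: "0 \<le> s"
    unfolding s_def using assms by simp
  \<comment> \<open>The terms of order k in \<rho> carry the k-th central moment of a
    \<open>p\<close>-biased bit: 0, \<open>s\<close>, \<open>s * (1 - 2 * p)\<close> and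
    \<open>s * (1 - 3 * s)\<close> for k = 1, 2, 3, 4.\<close>
  have L: "?L = a\<^sup>2 * c\<^sup>2 + s * (\<rho>\<^sup>2 * (a\<^sup>2 * d\<^sup>2 + b\<^sup>2 * c\<^sup>2 + 4 * (a * d) * (b * c))
      + \<rho>^3 * ((1 - 2 * p) * (2 * a * b * d\<^sup>2 + 2 * c * d * b\<^sup>2))
      + \<rho>^4 * ((1 - 3 * s) * (b\<^sup>2 * d\<^sup>2)))"
    unfolding s_def by algebra
  \<comment> \<open>AM-GM moves the cross term onto the mixed squares, raising their second-order
    coefficient from 1 to 3.\<close>
  have 1: "4 * (a * d) * (b * c) \<le> 2 * (a\<^sup>2 * d\<^sup>2 + b\<^sup>2 * c\<^sup>2)"
    using sum_squares_bound[of "a * d" "b * c"] by (simp add: power_mult_distrib)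
  have *: "\<bar>2 * x * y * z\<^sup>2\<bar> \<le> x\<^sup>2 * z\<^sup>2 + y\<^sup>2 * z\<^sup>2" for x y z :: real
  proof -
    have "2 * \<bar>x\<bar> * \<bar>y\<bar> \<le> x\<^sup>2 + y\<^sup>2"
      using sum_squares_bound[of "\<bar>x\<bar>" "\<bar>y\<bar>"] by simp
    then have "2 * \<bar>x\<bar> * \<bar>y\<bar> * z\<^sup>2 \<le> (x\<^sup>2 + y\<^sup>2) * z\<^sup>2"
      by (rule mult_right_mono) simp
    then show ?thesis
      by (simp add: abs_mult algebra_simps)
  qed
  \<comment> \<open>Each third-order term gives one mixed square and one
    \<open>b\<^sup>2 * d\<^sup>2\<close>. This is the source of \<rho>^3 and 2 \<rho>^3 in the two
    final coefficients.\<close>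
  have "\<bar>2 * a * b * d\<^sup>2 + 2 * c * d * b\<^sup>2\<bar> \<le> a\<^sup>2 * d\<^sup>2 + b\<^sup>2 * c\<^sup>2 + 2 * (b\<^sup>2 * d\<^sup>2)"
    using *[of a b d] *[of c d b] by (simp add: mult.commute)
  moreover have "\<bar>1 - 2 * p\<bar> \<le> 1"
    using assms by auto
  ultimately have "\<bar>1 - 2 * p\<bar> * \<bar>2 * a * b * d\<^sup>2 + 2 * c * d * b\<^sup>2\<bar>
      \<le> 1 * (a\<^sup>2 * d\<^sup>2 + b\<^sup>2 * c\<^sup>2 + 2 * (b\<^sup>2 * d\<^sup>2))"
    by (intro mult_mono) auto
  then have 2: "(1 - 2 * p) * (2 * a * b * d\<^sup>2 + 2 * c * d * b\<^sup>2)
      \<le> a\<^sup>2 * d\<^sup>2 + b\<^sup>2 * c\<^sup>2 + 2 * (b\<^sup>2 * d\<^sup>2)"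
    by (simp add: abs_mult[symmetric])
  have 3: "(1 - 3 * s) * (b\<^sup>2 * d\<^sup>2) \<le> b\<^sup>2 * d\<^sup>2"
    using s by (simp add: left_diff_distrib)
  have "?L \<le> a\<^sup>2 * c\<^sup>2 + s * (\<rho>\<^sup>2 * (a\<^sup>2 * d\<^sup>2 + b\<^sup>2 * c\<^sup>2 + 2 * (a\<^sup>2 * d\<^sup>2 + b\<^sup>2 * c\<^sup>2))
      + \<rho>^3 * (a\<^sup>2 * d\<^sup>2 + b\<^sup>2 * c\<^sup>2 + 2 * (b\<^sup>2 * d\<^sup>2)) + \<rho>^4 * (b\<^sup>2 * d\<^sup>2))"
    unfolding L using 1 2 3 s assms
    by (intro add_left_mono mult_left_mono add_mono order_refl) auto
  also have "\<dots> = ?R"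
    unfolding s_def by algebra
  finally show ?thesis .
qed

text \<open>Expanding in \<open>v\<close> pairs the mean of one function with the difference of the
  other, so the induction has to allow \<open>f\<close> and \<open>g\<close> to differ.
  \<open>rho2\<close> controls the pairs with one difference, \<open>rho3\<close> the pair of two
  differences.\<close>

lemma expectation_noise_squares_le:
  assumes "finite V" "0 \<le> p" "p \<le> 1" "0 \<le> \<rho>" "\<rho> \<le> 1" "0 \<le> r" "r \<le> 1" "0 \<le> l"
    and rho2: "3 * \<rho>\<^sup>2 + \<rho>^3 \<le> r\<^sup>2" and rho3: "2 * \<rho>^3 + \<rho>^4 \<le> l * r^4"
  shows "measure_pmf.expectation (mu p V) (\<lambda>x. (noise \<rho> p V f x)\<^sup>2 * (noise \<rho> p V g x)\<^sup>2)
    \<le> (\<Sum>S\<in>Pow V. (l * (p * (1 - p))) ^ card S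
        * (gen_influence p V S (noise r p V f) * gen_influence p V S (noise r p V g)))"
  using assms(1)
proof (induction V arbitrary: f g rule: finite_induct)
  case empty
  then show ?case
    by (simp add: gen_influence_empty mu_def noise_def noise_dist_def)
next
  case (insert v V)
  note pr = assms(2-7)
  let ?s = "p * (1 - p)"
  let ?A = "3 * \<rho>\<^sup>2 + \<rho>^3" and ?B = "2 * \<rho>^3 + \<rho>^4"
  let ?T = "noise \<rho> p V"
  let ?K = "\<lambda>f S. gen_influence p V S (noise r p V f)"
  let ?E = "\<lambda>f g. measure_pmf.expectation (mu p V) (\<lambda>x. (?T f x)\<^sup>2 * (?T g x)\<^sup>2)"
  let ?Q = "\<lambda>f g. \<Sum>S\<in>Pow V. (l * ?s) ^ card S * (?K f S * ?K g S)"
  let ?h = "\<lambda>x. (noise \<rho> p (insert v V) f x)\<^sup>2 * (noise \<rho> p (insert v V) g x)\<^sup>2"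
  define a b c d where abcd: "a = coord_mean p v f" "b = coord_diff v f"
    "c = coord_mean p v g" "d = coord_diff v g"
  have s: "0 \<le> ?s"
    using pr by simp
  have Q0: "0 \<le> ?Q f' g'" for f' g'
    using pr assms(8) by (intro sum_nonneg mult_nonneg_nonneg zero_le_power gen_influence_nonneg) auto
  have fin: "finite S" "v \<notin> S" if "S \<in> Pow V" for S
    using that insert.hyps finite_subset by auto
  have "coord_mean p v ?h x \<le> (?T a x)\<^sup>2 * (?T c x)\<^sup>2
      + ?s * (?A * ((?T a x)\<^sup>2 * (?T d x)\<^sup>2 + (?T b x)\<^sup>2 * (?T c x)\<^sup>2)
        + ?B * ((?T b x)\<^sup>2 * (?T d x)\<^sup>2))" for x
    using two_point_inequality[OF pr(1,2,3), of "?T a x" "?T b x" "?T c x" "?T d x"]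
    unfolding noise_insert[OF insert.hyps(1,2) pr(1-4)] abcd[symmetric]
    by (simp add: coord_mean_def noise_upd[OF insert.hyps(1,2)])
  then have "measure_pmf.expectation (mu p V) (coord_mean p v ?h)
      \<le> measure_pmf.expectation (mu p V) (\<lambda>x. (?T a x)\<^sup>2 * (?T c x)\<^sup>2
      + ?s * (?A * ((?T a x)\<^sup>2 * (?T d x)\<^sup>2 + (?T b x)\<^sup>2 * (?T c x)\<^sup>2)
        + ?B * ((?T b x)\<^sup>2 * (?T d x)\<^sup>2)))"
    using insert.hyps(1) by (intro integral_mono) auto
  then have "measure_pmf.expectation (mu p (insert v V)) ?h
      \<le> ?E a c + ?s * (?A * (?E a d + ?E b c) + ?B * ?E b d)"
    using insert.hyps pr by (simp add: expectation_mu_insert)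
  also have "\<dots> \<le> ?Q a c + ?s * (?A * (?Q a d + ?Q b c) + ?B * ?Q b d)"
    using pr s by (intro add_mono mult_left_mono insert.IH) auto
  also have "\<dots> \<le> ?Q a c + ?s * (r\<^sup>2 * (?Q a d + ?Q b c) + (l * r^4) * ?Q b d)"
    using s Q0 rho2 rho3
    by (intro add_left_mono add_mono mult_left_mono mult_right_mono add_nonneg_nonneg) auto
  \<comment> \<open>A nonnegative multiple of \<open>?Q b d\<close> is added to complete the product
    of the two influence recursions for sets without \<open>v\<close>.\<close>
  also have "\<dots> \<le> ?Q a c + ?s * (r\<^sup>2 * (?Q a d + ?Q b c) + (?s * r^4 + l * r^4) * ?Q b d)"
    using s Q0 pr
    by (intro add_left_mono add_mono mult_left_mono mult_right_mono) auto
  also have "\<dots> = (\<Sum>S\<in>Pow V. (l * ?s) ^ card S * (?K a S * ?K c S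
      + ?s * (r\<^sup>2 * (?K a S * ?K d S + ?K b S * ?K c S)
        + (?s * r^4 + l * r^4) * (?K b S * ?K d S))))"
    by (simp add: sum_distrib_left sum.distrib distrib_left mult.left_commute)
  also have "\<dots> = (\<Sum>S\<in>Pow (insert v V). (l * ?s) ^ card S
        * (gen_influence p (insert v V) S (noise r p (insert v V) f)
          * gen_influence p (insert v V) S (noise r p (insert v V) g)))"
    unfolding sum_Pow_insert[OF insert.hyps(1,2)]
  proof (rule sum.cong[OF refl], goal_cases)
    case (1 S)
    then have S: "S \<subseteq> V"
      by auto
    \<comment> \<open>\<open>X\<close> is the weight of \<open>S\<close>, and \<open>k1\<close> to
      \<open>k4\<close> are the influences at \<open>S\<close> for \<open>a\<close>,
      \<open>b\<close>, \<open>c\<close>, \<open>d\<close>. On the right the first summand belongs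
      to \<open>S\<close>, the second to \<open>insert v S\<close>.\<close>
    have *: "X * (k1 * k3 + s * (r\<^sup>2 * (k1 * k4 + k2 * k3) + (s * r^4 + l * r^4) * (k2 * k4)))
      = X * ((k1 + s * r\<^sup>2 * k2) * (k3 + s * r\<^sup>2 * k4))
        + (l * s * X) * ((r\<^sup>2 * k2) * (r\<^sup>2 * k4))" for X s k1 k2 k3 k4 :: real
      by algebra
    show ?case
      unfolding gen_influence_noise_insert_notin[OF insert.hyps(1,2) S pr(1,2) pr(5,6)]
        gen_influence_noise_insert_insert[OF insert.hyps(1,2) S pr(1,2) pr(5,6)] abcd[symmetric]
      by (simp only: card_insert_disjoint[OF fin[OF 1]] power_Suc *)
  qed
  finally show ?case .
qed

section \<open>The fourth moment bound and the norm inequality\<close>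

lemma expectation_noise_power4_le:
  assumes "finite V" "0 \<le> p" "p \<le> 1" "0 \<le> \<rho>" "\<rho> \<le> 1" "0 \<le> r" "r \<le> 1" "0 \<le> l"
    and "3 * \<rho>\<^sup>2 + \<rho>^3 \<le> r\<^sup>2" "2 * \<rho>^3 + \<rho>^4 \<le> l * r^4" "(1 + l) * r\<^sup>2 \<le> 1"
    and small: "small_gen_influences \<beta> p V f"
  shows "measure_pmf.expectation (mu p V) (\<lambda>x. (noise \<rho> p V f x)^4)
    \<le> \<beta> * (measure_pmf.expectation (mu p V) (\<lambda>x. (f x)\<^sup>2))\<^sup>2"
proof -
  let ?s = "p * (1 - p)"
  let ?M = "measure_pmf.expectation (mu p V) (\<lambda>x. (f x)\<^sup>2)"
  let ?K = "\<lambda>S. gen_influence p V S (noise r p V f)"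
  have infl: "gen_influence p V S f \<le> \<beta> * ?M" if "S \<subseteq> V" for S
    using small that by (auto simp: small_gen_influences_def)
  \<comment> \<open>The empty set supplies the sign: its influence is nonnegative and bounded by
    \<beta> times the second moment.\<close>
  have "0 \<le> \<beta> * ?M"
    using infl[of "{}"] gen_influence_nonneg[of p V "{}" f] by simp
  have "measure_pmf.expectation (mu p V) (\<lambda>x. (noise \<rho> p V f x)^4)
      = measure_pmf.expectation (mu p V) (\<lambda>x. (noise \<rho> p V f x)\<^sup>2 * (noise \<rho> p V f x)\<^sup>2)"
    by (simp add: power_add[symmetric])
  also have "\<dots> \<le> (\<Sum>S\<in>Pow V. (l * ?s) ^ card S * (?K S * ?K S))"
    using assms by (intro expectation_noise_squares_le) auto
  \<comment> \<open>Smallness is spent on one of the two equal factors; the other stays for the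
    weighted sum over all \<open>S\<close>.\<close>
  also have "\<dots> \<le> (\<Sum>S\<in>Pow V. (l * ?s) ^ card S * (\<beta> * ?M * ?K S))"
  proof (intro sum_mono mult_left_mono mult_right_mono gen_influence_nonneg)
    fix S assume "S \<in> Pow V"
    then show "?K S \<le> \<beta> * ?M"
      using gen_influence_noise_le[of V S p r f] infl[of S] assms by auto
  qed (use assms in auto)
  also have "\<dots> = \<beta> * ?M * (\<Sum>S\<in>Pow V. (l * ?s) ^ card S * ?K S)"
    by (simp add: sum_distrib_left mult_ac)
  also have "\<dots> \<le> \<beta> * ?M * ?M"
    using assms \<open>0 \<le> \<beta> * ?M\<close> by (intro mult_left_mono sum_gen_influence_noise_le) auto
  finally show ?thesis
    by (simp add: power2_eq_square mult.assoc)
qed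

theorem theorem1p3:
  fixes n :: nat and p \<beta> :: real and f :: "(nat \<Rightarrow> bool) \<Rightarrow> real"
  assumes "0 < p" and "p \<le> 1 / 2"
    and "small_gen_influences \<beta> p {1..n} f"
  shows "mu_norm 4 p {1..n} (noise (1 / 5) p {1..n} f)
           \<le> \<beta> powr (1 / 4) * mu_norm 2 p {1..n} f"
proof -
  let ?E = "measure_pmf.expectation (mu p {1..n})"
  let ?M = "?E (\<lambda>x. (f x)\<^sup>2)"
  let ?X = "?E (\<lambda>x. (noise (1 / 5) p {1..n} f x)^4)"
  \<comment> \<open>The choice makes \<open>(1 + l) * r\<^sup>2\<close> exactly 1, and the other two
    conditions read 16/125 \<le> 1/4 and 11/625 \<le> 3/16.\<close>
  have le: "?X \<le> \<beta> * ?M\<^sup>2"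
    using assms
    by (intro expectation_noise_power4_le[where r = "1 / 2" and l = 3])
      (auto simp: power_numeral_reduce)
  have X0: "0 \<le> ?X" and M0: "0 \<le> ?M"
    by (intro Bochner_Integration.integral_nonneg; simp)+
  have pow: "\<bar>x\<bar> powr 4 = x^4" "\<bar>x\<bar> powr 2 = x\<^sup>2" for x :: real
    by (simp_all add: powr_numeral)
  have "?X powr (1 / 4) \<le> \<beta> powr (1 / 4) * ?M powr (1 / 2)"
  proof (cases "?M = 0")
    case True
    \<comment> \<open>A zero second moment squeezes the fourth moment to zero, whatever the sign of
      \<beta>.\<close>
    then have "?X = 0"
      using le X0 by (intro antisym) (simp_all only: power_zero_numeral mult_zero_right)
    then show ?thesis
      using True by (simp only:) simp
  next
    case False
    then have "0 < ?M"
      using M0 by linarith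
    have "?X powr (1 / 4) \<le> (\<beta> * ?M\<^sup>2) powr (1 / 4)"
      using le X0 by (intro powr_mono2) auto
    also have "\<dots> = \<beta> powr (1 / 4) * (?M\<^sup>2) powr (1 / 4)"
      by (rule powr_mult)
    also have "?M\<^sup>2 = ?M powr 2"
      using \<open>0 < ?M\<close> by (simp only: powr_numeral)
    also have "(?M powr 2) powr (1 / 4) = ?M powr (1 / 2)"
      by (subst powr_powr) simp
    finally show ?thesis .
  qed
  then show ?thesis
    unfolding mu_norm_def pow .
qed

end
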